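(* Let $k$ be an algebraically closed field, let $n\ge 1$, and let $I\subseteq k[x_1,\dots,x_n]$ be an ideal such that $I\cap k[x_1]=\langle p\rangle$ (the ideal of $k[x_1]$ generated by $p$) for some $p\in k[x_1]\setminus k$. Then there exists $a\in k$ with $p(a)=0$ such that $\mathrm{ev}_a(I)\neq k[x_2,\dots,x_n]$.
   Context: For a field $k$ and $a\in k$, $\mathrm{ev}_a:k[x_1,x_2,\dots,x_n]\to k[x_2,\dots,x_n]$ denotes the evaluation homomorphism $f(x_1,x_2,\dots,x_n)\mapsto f(a,x_2,\dots,x_n)$, and $\mathrm{ev}_a(I)=\{\mathrm{ev}_a(f) : f\in I\}$. When $n=1$, $k[x_2,\dots,x_n]$ means $k$. *)

theory Defs
  imports
    "HOL-Algebra.Ideal"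
    "HOL-Algebra.RingHom"
    "HOL-Library.Poly_Mapping"
    "HOL-Computational_Algebra.Polynomial"
begin

text \<open>
  A monomial is a finitely supported exponent function on variable indices, and a polynomial is a
  finitely supported coefficient function on monomials.  The product on
  \<^typ>\<open>(nat \<Rightarrow>\<^sub>0 nat) \<Rightarrow>\<^sub>0 'k::comm_ring_1\<close> provided by the library is convolution.
\<close>

type_synonym 'k mpoly = "(nat \<Rightarrow>\<^sub>0 nat) \<Rightarrow>\<^sub>0 'k"

text \<open>
  \<open>mpoly_ring V\<close> is $k[x_i : i \in V]$.  All these rings live in one type, so that
  $k[x_1]$ and $k[x_2,\dots,x_n]$ are literally subrings of $k[x_1,\dots,x_n]$, and
  \<open>mpoly_ring {}\<close> is the ring of constants $k$.
\<close>

definition mpoly_ring :: "nat set \<Rightarrow> 'k::comm_ring_1 mpoly ring" where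
  "mpoly_ring V =
     \<lparr>carrier = {f. \<forall>m\<in>Poly_Mapping.keys f. Poly_Mapping.keys m \<subseteq> V},
      monoid.mult = (*), one = 1, ring.zero = 0, add = (+)\<rparr>"

text \<open>
  Each term $c\, x_1^{e_1} x_2^{e_2} \cdots x_n^{e_n}$ of the argument is sent to
  $c\, a^{e_1} x_2^{e_2} \cdots x_n^{e_n}$.
  For $f \in k[x_1]$ the result is $f(a)$, viewed as a constant polynomial.
\<close>

definition ev :: "'k::comm_ring_1 \<Rightarrow> 'k mpoly \<Rightarrow> 'k mpoly" where
  "ev a f = (\<Sum>m\<in>Poly_Mapping.keys f.
     Poly_Mapping.single (Poly_Mapping.update 1 0 m)
       (Poly_Mapping.lookup f m * a ^ Poly_Mapping.lookup m 1))"

lemma carrier_mpoly_ring_iff: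
  "f \<in> carrier (mpoly_ring V) \<longleftrightarrow> (\<forall>m\<in>Poly_Mapping.keys f. Poly_Mapping.keys m \<subseteq> V)"
  by (simp add: mpoly_ring_def)

lemma mpoly_ring_simps [simp]:
  "monoid.mult (mpoly_ring V) = (*)"
  "monoid.one (mpoly_ring V) = 1"
  "ring.zero (mpoly_ring V) = 0"
  "ring.add (mpoly_ring V) = (+)"
  by (simp_all add: mpoly_ring_def)

lemma mpoly_ring_add_closed:
  "f \<in> carrier (mpoly_ring V) \<Longrightarrow> g \<in> carrier (mpoly_ring V) \<Longrightarrow> f + g \<in> carrier (mpoly_ring V)"
  using Poly_Mapping.keys_add[of f g] by (auto simp: carrier_mpoly_ring_iff)

lemma sum_in_carrier_mpoly_ring:
  "(\<And>x. x \<in> A \<Longrightarrow> h x \<in> carrier (mpoly_ring V)) \<Longrightarrow> sum h A \<in> carrier (mpoly_ring V)"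
proof (induction A rule: infinite_finite_induct)
  case (insert x A)
  then show ?case by (simp add: mpoly_ring_add_closed)
qed (simp_all add: carrier_mpoly_ring_iff)

lemma mpoly_ring_uminus_closed:
  "f \<in> carrier (mpoly_ring V) \<Longrightarrow> - f \<in> carrier (mpoly_ring V)"
  by (simp add: carrier_mpoly_ring_iff in_keys_iff)

lemma mpoly_ring_mult_closed:
  assumes "f \<in> carrier (mpoly_ring V)" "g \<in> carrier (mpoly_ring V)"
  shows "f * g \<in> carrier (mpoly_ring V)"
  unfolding carrier_mpoly_ring_iff
proof
  fix m assume "m \<in> Poly_Mapping.keys (f * g)"
  then obtain s t where m: "m = s + t" and "s \<in> Poly_Mapping.keys f" "t \<in> Poly_Mapping.keys g"
    using Poly_Mapping.keys_mult[of f g] by blast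
  then have "Poly_Mapping.keys s \<subseteq> V" "Poly_Mapping.keys t \<subseteq> V"
    using assms by (auto simp: carrier_mpoly_ring_iff)
  then show "Poly_Mapping.keys m \<subseteq> V"
    unfolding m using Poly_Mapping.keys_add[of s t] by blast
qed

lemma cring_mpoly_ring: "cring (mpoly_ring V :: 'k::comm_ring_1 mpoly ring)"
proof (rule cringI)
  have "(0 :: 'k mpoly) \<in> carrier (mpoly_ring V)"
    by (simp add: carrier_mpoly_ring_iff)
  moreover have "\<exists>g\<in>carrier (mpoly_ring V). g + f = 0"
    if "f \<in> carrier (mpoly_ring V)" for f :: "'k mpoly"
    using that by (intro bexI[of _ "- f"]) (auto intro: mpoly_ring_uminus_closed)
  ultimately show "abelian_group (mpoly_ring V :: 'k mpoly ring)"
    by (intro abelian_groupI) (auto intro: mpoly_ring_add_closed simp: add_ac)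
  show "comm_monoid (mpoly_ring V :: 'k mpoly ring)"
  proof (rule comm_monoidI)
    show "monoid.one (mpoly_ring V :: 'k mpoly ring) \<in> carrier (mpoly_ring V)"
      by (simp add: carrier_mpoly_ring_iff)
  qed (auto intro: mpoly_ring_mult_closed simp: mult_ac)
qed (auto simp: algebra_simps)

lemma ev_zero [simp]: "ev a 0 = 0"
  by (simp add: ev_def)

lemma ev_single:
  "ev a (Poly_Mapping.single m c) =
     Poly_Mapping.single (Poly_Mapping.update 1 0 m) (c * a ^ Poly_Mapping.lookup m 1)"
  by (simp add: ev_def)

lemma ev_one [simp]: "ev a 1 = 1"
proof -
  have "Poly_Mapping.update 1 0 (0 :: nat \<Rightarrow>\<^sub>0 nat) = 0"
    by (rule poly_mapping_eqI) (simp add: lookup_update)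
  then show ?thesis
    using ev_single[of a 0 1] by simp
qed

lemma ev_add: "ev a (f + g) = ev a f + ev a g"
  unfolding ev_def
  by (rule setsum_keys_plus_distrib) (simp_all add: single_add distrib_right)

lemma ev_mult_single:
  "ev a (Poly_Mapping.single m c * Poly_Mapping.single l d) =
     ev a (Poly_Mapping.single m c) * ev a (Poly_Mapping.single l d)"
proof -
  have "Poly_Mapping.update 1 0 (m + l) = Poly_Mapping.update 1 0 m + Poly_Mapping.update 1 0 l"
    by (rule poly_mapping_eqI) (simp add: lookup_update lookup_add)
  then show ?thesis
    unfolding mult_single ev_single by (simp add: lookup_add power_add mult_ac)
qed

lemma mpoly_induct [case_names zero add]:
  fixes f :: "'k::comm_ring_1 mpoly"
  assumes "P 0" and "\<And>m c f. P f \<Longrightarrow> P (Poly_Mapping.single m c + f)"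
  shows "P f"
proof (induction f rule: update_induct)
  case const
  show ?case by (rule assms(1))
next
  case (update f m c)
  have "Poly_Mapping.update m c f = Poly_Mapping.single m c + f"
    using update.hyps
    by (intro poly_mapping_eqI)
       (auto simp: lookup_update lookup_add lookup_single in_keys_iff)
  then show ?case
    using assms(2) update.IH by simp
qed

lemma ev_mult: "ev a (f * g) = ev a f * ev a g"
proof -
  have *: "ev a (Poly_Mapping.single m c * g) = ev a (Poly_Mapping.single m c) * ev a g" for m c
    by (induction g rule: mpoly_induct) (simp_all add: distrib_left ev_add ev_mult_single)
  show ?thesis
    by (induction f rule: mpoly_induct) (simp_all add: distrib_right ev_add *)
qed

lemma ev_closed:
  assumes "f \<in> carrier (mpoly_ring {1..n})"
  shows "ev a f \<in> carrier (mpoly_ring {2..n})"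
proof -
  have "Poly_Mapping.single (Poly_Mapping.update 1 0 m) c \<in> carrier (mpoly_ring {2..n})"
    if "m \<in> Poly_Mapping.keys f" for m c
  proof -
    have "Poly_Mapping.keys m \<subseteq> {1..n}"
      using assms that by (auto simp: carrier_mpoly_ring_iff)
    moreover have "{1..n} - {1} \<subseteq> {2..n}" by auto
    ultimately have "Poly_Mapping.keys (Poly_Mapping.update 1 0 m) \<subseteq> {2..n}"
      by (auto simp: keys_update)
    then show ?thesis
      by (auto simp: carrier_mpoly_ring_iff)
  qed
  then show ?thesis
    unfolding ev_def
    by (intro sum_in_carrier_mpoly_ring) auto
qed

lemma ev_ring_hom: "ev a \<in> ring_hom (mpoly_ring {1..n}) (mpoly_ring {2..n})"
  by (rule ring_hom_memI) (simp_all add: ev_closed ev_mult ev_add del: One_nat_def)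

text \<open>
  Hence \<open>ev a\<close> is the $k$-algebra homomorphism with $x_1 \mapsto a$ and
  $x_i \mapsto x_i$ for $i \neq 1$.
\<close>

lemma ev_const: "ev a (Poly_Mapping.single 0 c) = Poly_Mapping.single 0 c"
proof -
  have "Poly_Mapping.update 1 0 (0 :: nat \<Rightarrow>\<^sub>0 nat) = 0"
    by (rule poly_mapping_eqI) (simp add: lookup_update)
  then show ?thesis by (simp add: ev_single)
qed

lemma ev_var:
  "ev a (Poly_Mapping.single (Poly_Mapping.single i 1) 1) =
     (if i = 1 then Poly_Mapping.single 0 a else Poly_Mapping.single (Poly_Mapping.single i 1) 1)"
proof -
  have "Poly_Mapping.update 1 0 (Poly_Mapping.single i (1::nat)) =
          (if i = 1 then 0 else Poly_Mapping.single i 1)"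
    by (rule poly_mapping_eqI) (auto simp: lookup_update lookup_single when_def)
  then show ?thesis
    by (simp add: ev_single lookup_single when_def)
qed

end

theory Submission
  imports Defs
begin

text \<open>
  If $\mathrm{ev}_a(I)$ is everything then some $f \in I$ has $\mathrm{ev}_a(f) = 1$, so
  $1 \in I + \langle x_1 - a \rangle$.  If this happens for every root $a$ of $p$, multiplying these
  relations over the linear factors of $p$ gives $1 \in I + \langle p \rangle = I$.  Then
  $1 \in \langle p \rangle$, which is refuted by evaluating at a root of $p$.
\<close>

definition mconst :: "'k::comm_ring_1 \<Rightarrow> 'k mpoly" where
  "mconst c = Poly_Mapping.single 0 c"

definition mvar :: "nat \<Rightarrow> 'k::comm_ring_1 mpoly" where
  "mvar i = Poly_Mapping.single (Poly_Mapping.single i 1) 1"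

lemma mconst_0 [simp]: "mconst 0 = 0"
  and mconst_1 [simp]: "mconst 1 = 1"
  and mconst_add: "mconst (c + d) = mconst c + mconst d"
  and mconst_mult: "mconst (c * d) = mconst c * mconst d"
  and mconst_minus: "mconst (- c) = - mconst c"
  by (simp_all add: mconst_def single_add mult_single single_uminus)

lemma mconst_power: "mconst (c ^ e) = mconst c ^ e"
  by (induction e) (simp_all add: mconst_mult)

lemma mvar_power: "mvar i ^ e = Poly_Mapping.single (Poly_Mapping.single i e) 1"
  by (induction e) (simp_all add: mvar_def mult_single flip: single_add)

lemma ev_mconst [simp]: "ev a (mconst c) = mconst c"
  by (simp only: mconst_def ev_const)

lemma ev_mvar_1 [simp]: "ev a (mvar 1) = mconst a"
  by (simp only: mconst_def mvar_def ev_var if_True refl)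

lemma mconst_closed: "mconst c \<in> carrier (mpoly_ring V)"
  by (simp add: mconst_def carrier_mpoly_ring_iff)

lemma mpoly_ring_one_closed: "1 \<in> carrier (mpoly_ring V)"
  using mconst_closed[of 1] by simp

lemma mvar_closed: "i \<in> V \<Longrightarrow> mvar i \<in> carrier (mpoly_ring V)"
  by (simp add: mvar_def carrier_mpoly_ring_iff)

lemma mpoly_ring_diff_closed:
  "f \<in> carrier (mpoly_ring V) \<Longrightarrow> g \<in> carrier (mpoly_ring V) \<Longrightarrow> f - g \<in> carrier (mpoly_ring V)"
  using mpoly_ring_add_closed[of f V "- g"] mpoly_ring_uminus_closed[of g V] by simp

lemma mpoly_ring_power_closed:
  "f \<in> carrier (mpoly_ring V) \<Longrightarrow> f ^ e \<in> carrier (mpoly_ring V)"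
  by (induction e) (simp_all add: mpoly_ring_one_closed mpoly_ring_mult_closed)

lemma mpoly_sum_monomials:
  "(\<Sum>m\<in>Poly_Mapping.keys f. Poly_Mapping.single m (Poly_Mapping.lookup f m)) = f"
  by (rule poly_mapping_eqI)
     (auto simp: lookup_sum lookup_single when_def in_keys_iff)

text \<open>Split off the power of \<open>x_1\<close>: the monomial is \<open>?r\<close> times
  \<open>x_1^e\<close>, and \<open>ev a\<close> turns \<open>x_1^e\<close> into \<open>a^e\<close>.
  The geometric sum \<open>?g\<close> is the quotient of \<open>x_1^e - a^e\<close> by
  \<open>x_1 - a\<close>. The quotient must stay in the ring over \<open>V\<close>, since ideals
  absorb only elements of that carrier.\<close>

lemma diff_ev_single_eq_mult:
  assumes "1 \<in> V" "Poly_Mapping.keys m \<subseteq> V"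
  shows "\<exists>g\<in>carrier (mpoly_ring V).
    Poly_Mapping.single m c - ev a (Poly_Mapping.single m c) = (mvar 1 - mconst a) * g"
proof -
  let ?e = "Poly_Mapping.lookup m 1" and ?r = "Poly_Mapping.update 1 0 m"
  let ?t = "Poly_Mapping.single ?r c"
  let ?g = "\<Sum>i<?e. mconst a ^ (?e - Suc i) * mvar 1 ^ i"
  have "m = ?r + Poly_Mapping.single 1 ?e"
    by (rule poly_mapping_eqI) (auto simp: lookup_add lookup_update lookup_single when_def)
  then have "Poly_Mapping.single m c = ?t * mvar 1 ^ ?e"
    by (metis mvar_power mult_single mult.right_neutral)
  moreover have "ev a (Poly_Mapping.single m c) = ?t * mconst a ^ ?e"
    by (simp only: ev_single flip: mconst_power) (simp add: mconst_def mult_single)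
  moreover have "mvar 1 ^ ?e - mconst a ^ ?e = (mvar 1 - mconst a) * ?g"
    by (rule power_diff_sumr2)
  ultimately have "Poly_Mapping.single m c - ev a (Poly_Mapping.single m c)
      = (mvar 1 - mconst a) * (?t * ?g)"
    by (metis (no_types, lifting) mult.left_commute right_diff_distrib)
  moreover have "?t \<in> carrier (mpoly_ring V)"
    using assms(2) by (auto simp: carrier_mpoly_ring_iff keys_update)
  then have "?t * ?g \<in> carrier (mpoly_ring V)"
    by (intro mpoly_ring_mult_closed sum_in_carrier_mpoly_ring mpoly_ring_power_closed
        mconst_closed mvar_closed assms(1))
  ultimately show ?thesis by blast
qed

text \<open>Evaluation at \<open>a\<close> is reduction modulo \<open>x_1 - a\<close>. Both
  \<open>f\<close> and \<open>ev a f\<close> are sums over the keys of \<open>f\<close>, so the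
  monomial case can be summed.\<close>

lemma diff_ev_eq_mult:
  assumes "1 \<in> V" "f \<in> carrier (mpoly_ring V)"
  shows "\<exists>g\<in>carrier (mpoly_ring V). f - ev a f = (mvar 1 - mconst a) * g"
proof -
  let ?s = "\<lambda>m. Poly_Mapping.single m (Poly_Mapping.lookup f m)"
  have "\<forall>m\<in>Poly_Mapping.keys f. \<exists>g\<in>carrier (mpoly_ring V).
      ?s m - ev a (?s m) = (mvar 1 - mconst a) * g"
    using assms by (intro ballI diff_ev_single_eq_mult) (auto simp only: carrier_mpoly_ring_iff)
  then obtain g where g: "\<And>m. m \<in> Poly_Mapping.keys f \<Longrightarrow> g m \<in> carrier (mpoly_ring V)"
    "\<And>m. m \<in> Poly_Mapping.keys f \<Longrightarrow> ?s m - ev a (?s m) = (mvar 1 - mconst a) * g m"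
    by metis
  have "ev a f = (\<Sum>m\<in>Poly_Mapping.keys f. ev a (?s m))"
    unfolding ev_single by (simp add: ev_def)
  then have "f - ev a f = (\<Sum>m\<in>Poly_Mapping.keys f. ?s m - ev a (?s m))"
    by (simp add: sum_subtractf mpoly_sum_monomials)
  also have "\<dots> = (mvar 1 - mconst a) * (\<Sum>m\<in>Poly_Mapping.keys f. g m)"
    by (simp add: g sum_distrib_left)
  finally show ?thesis
    using g(1) by (blast intro: sum_in_carrier_mpoly_ring)
qed

text \<open>The embedding of univariate polynomials as \<open>k[x_1]\<close>, given by substituting
  \<open>x_1\<close> for the indeterminate. It makes degrees, linear factors and roots from the
  univariate library available for \<open>p\<close>.\<close>

definition mpoly_of_poly :: "'k::comm_ring_1 poly \<Rightarrow> 'k mpoly" where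
  "mpoly_of_poly q = poly (map_poly mconst q) (mvar 1)"

lemma mpoly_of_poly_0 [simp]: "mpoly_of_poly 0 = 0"
  by (simp add: mpoly_of_poly_def)

lemma mpoly_of_poly_pCons [simp]:
  "mpoly_of_poly (pCons c q) = mconst c + mvar 1 * mpoly_of_poly q"
  by (simp add: mpoly_of_poly_def map_poly_pCons)

lemma mpoly_of_poly_add: "mpoly_of_poly (q + r) = mpoly_of_poly q + mpoly_of_poly r"
  by (induction q r rule: poly_induct2) (simp_all add: mconst_add algebra_simps)

lemma mpoly_of_poly_smult: "mpoly_of_poly (smult c q) = mconst c * mpoly_of_poly q"
  by (induction q) (simp_all add: mconst_mult algebra_simps)

lemma mpoly_of_poly_mult: "mpoly_of_poly (q * r) = mpoly_of_poly q * mpoly_of_poly r"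
  by (induction q) (simp_all add: mpoly_of_poly_add mpoly_of_poly_smult algebra_simps)

lemma mpoly_of_poly_sum: "mpoly_of_poly (sum q A) = (\<Sum>x\<in>A. mpoly_of_poly (q x))"
  by (induction A rule: infinite_finite_induct) (simp_all add: mpoly_of_poly_add)

lemma mpoly_of_poly_monom:
  "mpoly_of_poly (monom c e) = Poly_Mapping.single (Poly_Mapping.single 1 e) c"
proof -
  have "mpoly_of_poly (monom c e) = mconst c * mvar 1 ^ e"
    by (induction e) (simp_all add: monom_0 monom_Suc mult_ac)
  then show ?thesis
    by (simp add: mconst_def mvar_power mult_single)
qed

text \<open>Translates the condition \<open>ev a p = 0\<close> into \<open>a\<close> being a root of
  the univariate preimage of \<open>p\<close>.\<close>

lemma ev_mpoly_of_poly: "ev a (mpoly_of_poly q) = mconst (poly q a)"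
  by (induction q) (simp_all add: ev_add ev_mult mconst_add mconst_mult del: One_nat_def)

text \<open>A monomial supported in \<open>{1}\<close> is determined by its exponent at 1, so every
  term of \<open>f\<close> is the image of a univariate monomial.\<close>

lemma mpoly_of_poly_surj:
  assumes "f \<in> carrier (mpoly_ring {1})"
  shows "\<exists>q. mpoly_of_poly q = f"
proof
  let ?q = "\<Sum>m\<in>Poly_Mapping.keys f. monom (Poly_Mapping.lookup f m) (Poly_Mapping.lookup m 1)"
  have "Poly_Mapping.single 1 (Poly_Mapping.lookup m 1) = m" if "m \<in> Poly_Mapping.keys f" for m
  proof (rule poly_mapping_eqI)
    have "Poly_Mapping.keys m \<subseteq> {1}"
      using assms that by (simp add: carrier_mpoly_ring_iff)
    then show "Poly_Mapping.lookup (Poly_Mapping.single 1 (Poly_Mapping.lookup m 1)) k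
        = Poly_Mapping.lookup m k" for k
      by (auto simp: lookup_single when_def in_keys_iff subset_iff)
  qed
  then show "mpoly_of_poly ?q = f"
    by (simp add: mpoly_of_poly_sum mpoly_of_poly_monom mpoly_sum_monomials del: One_nat_def)
qed

text \<open>Induction on the degree, splitting off one linear factor at a time. The polynomial is
  generalized because the hypothesis on roots must pass to the cofactor.\<close>

lemma one_in_ideal_plus_poly:
  fixes q :: "'k::alg_closed_field poly"
  assumes I: "ideal I (mpoly_ring V)" and V: "1 \<in> V" and "q \<noteq> 0"
    and roots: "\<And>a. poly q a = 0 \<Longrightarrow> 1 \<in> ev a ` I"
  shows "\<exists>f\<in>I. \<exists>g\<in>carrier (mpoly_ring V). 1 = f + mpoly_of_poly q * g"
  using assms(3,4)
proof (induction "degree q" arbitrary: q)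
  case 0
  interpret I: ideal I "mpoly_ring V" by (rule I)
  from 0 obtain c where c: "q = [:c:]" "c \<noteq> 0"
    by (metis degree_eq_zeroE pCons_0_0)
  \<comment> \<open>A nonzero constant is a unit, so the ideal contributes nothing here.\<close>
  then have "1 = 0 + mpoly_of_poly q * mconst (inverse c)"
    by (simp flip: mconst_mult)
  moreover have "0 \<in> I" using additive_subgroup.zero_closed[OF I.additive_subgroup_axioms] by simp
  ultimately show ?case using mconst_closed by blast
next
  case (Suc d)
  interpret I: ideal I "mpoly_ring V" by (rule I)
  obtain a where a: "poly q a = 0"
    using Suc.hyps(2) by (metis alg_closed_imp_poly_has_root zero_less_Suc)
  then obtain r where r: "q = [:- a, 1:] * r"
    by (metis poly_eq_0_iff_dvd dvdE)
  then have "r \<noteq> 0" using Suc.prems(1) by auto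
  moreover from this have "d = degree r"
    using Suc.hyps(2) unfolding r by (subst (asm) degree_mult_eq) auto
  \<comment> \<open>Roots of the factor \<open>r\<close> are roots of \<open>q\<close>.\<close>
  moreover have "1 \<in> ev b ` I" if "poly r b = 0" for b
    using that by (intro Suc.prems(2)) (simp add: r)
  ultimately obtain f g where fg: "f \<in> I" "g \<in> carrier (mpoly_ring V)"
    "1 = f + mpoly_of_poly r * g"
    using Suc.hyps(1) by blast
  obtain h where h: "h \<in> I" "1 = ev a h" using Suc.prems(2)[OF a] by blast
  then have "h \<in> carrier (mpoly_ring V)" by (simp add: I.Icarr)
  \<comment> \<open>As \<open>ev a h = 1\<close>, the difference \<open>h - ev a h\<close> is
    \<open>h - 1\<close>, so 1 equals an element of \<open>I\<close> plus a multiple of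
    \<open>x_1 - a\<close>.\<close>
  from diff_ev_eq_mult[OF V this, of a] obtain l where
    l: "l \<in> carrier (mpoly_ring V)" "h - 1 = (mvar 1 - mconst a) * l"
    unfolding h(2)[symmetric] by blast
  have q: "mpoly_of_poly q = (mvar 1 - mconst a) * mpoly_of_poly r"
    unfolding r mpoly_of_poly_mult by (simp add: mconst_minus)
  have "mpoly_of_poly r * g = 1 - f" using fg(3) by (metis add_diff_cancel_left')
  moreover have "mpoly_of_poly q * (g * - l) =
      - ((mpoly_of_poly r * g) * ((mvar 1 - mconst a) * l))"
    unfolding q by (simp only: mult_minus_left mult_minus_right mult_ac)
  \<comment> \<open>The relations for \<open>r\<close> and for \<open>x_1 - a\<close> are
    multiplied: \<open>(1 - f) * (1 - h)\<close> is a multiple of \<open>q\<close>. Expanding it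
    leaves 1 minus \<open>f + (1 - f) * h\<close>, which lies in \<open>I\<close>.\<close>
  ultimately have "mpoly_of_poly q * (g * - l) = - ((1 - f) * (h - 1))"
    by (simp only: l(2))
  then have "1 = (f + (1 - f) * h) + mpoly_of_poly q * (g * - l)"
    by (simp only:) (simp add: algebra_simps)
  moreover have "1 - f \<in> carrier (mpoly_ring V)"
    using fg(1) by (simp add: I.Icarr mpoly_ring_diff_closed mpoly_ring_one_closed)
  then have "f + (1 - f) * h \<in> I"
    using additive_subgroup.a_closed[OF I.additive_subgroup_axioms fg(1)]
      I.I_l_closed[OF h(1), of "1 - f"] by simp
  moreover have "g * - l \<in> carrier (mpoly_ring V)"
    using fg(2) l(1) by (blast intro: mpoly_ring_mult_closed mpoly_ring_uminus_closed)
  ultimately show ?case by blast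
qed

theorem lemma1:
  fixes n :: nat
    and I :: "'k::alg_closed_field mpoly set"
    and p :: "'k mpoly"
  assumes "n \<ge> 1"
    and "ideal I (mpoly_ring {1..n})"
    and "p \<in> carrier (mpoly_ring {1}) - carrier (mpoly_ring {})"
    and "I \<inter> carrier (mpoly_ring {1}) = genideal (mpoly_ring {1}) {p}"
  shows "\<exists>a::'k. ev a p = 0 \<and> ev a ` I \<noteq> carrier (mpoly_ring {2..n})"
proof (rule ccontr)
  assume contr: "\<not> ?thesis"
  interpret I: ideal I "mpoly_ring {1..n}" by (rule assms(2))
  interpret U: cring "mpoly_ring {1} :: 'k mpoly ring" by (rule cring_mpoly_ring)
  have p: "p \<in> carrier (mpoly_ring {1})" using assms(3) by blast
  then obtain q where q: "p = mpoly_of_poly q" using mpoly_of_poly_surj by metis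
  \<comment> \<open>A constant \<open>q\<close> would make \<open>p\<close> constant. Positive
    degree gives both \<open>q\<close> nonzero and, at the end, a root.\<close>
  have deg: "degree q > 0"
  proof (rule ccontr)
    assume "\<not> degree q > 0"
    then obtain c where "q = [:c:]" by (metis degree_eq_zeroE not_gr_zero)
    then show False using assms(3) q mconst_closed[of c "{}"] by simp
  qed
  have "1 \<in> ev a ` I" if "poly q a = 0" for a
    using contr that mpoly_ring_one_closed by (auto simp: q ev_mpoly_of_poly)
  moreover have "1 \<in> {1..n}" using assms(1) by simp
  ultimately obtain f g where fg: "f \<in> I" "g \<in> carrier (mpoly_ring {1..n})" "1 = f + p * g"
    using one_in_ideal_plus_poly[OF assms(2), of q] deg unfolding q by fastforce
  have "p \<in> I" using U.genideal_self'[OF p] assms(4) by blast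
  then have "f + p * g \<in> I"
    using additive_subgroup.a_closed[OF I.additive_subgroup_axioms fg(1)]
      I.I_r_closed[OF _ fg(2)] by simp
  then have "1 \<in> I" by (simp only: fg(3))
  \<comment> \<open>1 lies in \<open>I\<close> and in \<open>k[x_1]\<close>. In a commutative ring
    the generated ideal is the set of multiples of \<open>p\<close>, which yields an explicit
    cofactor.\<close>
  then have "1 \<in> cgenideal (mpoly_ring {1}) p"
    using assms(4) mpoly_ring_one_closed U.cgenideal_eq_genideal[OF p] by blast
  then obtain h where h: "1 = h * p"
    by (auto simp: cgenideal_def)
  \<comment> \<open>At a root, \<open>ev a\<close> sends \<open>h * p\<close> to 0 but fixes
    1.\<close>
  obtain a where "poly q a = 0"
    using alg_closed_imp_poly_has_root[OF deg] by blast
  then have "ev a (h * p) = 0" by (simp add: ev_mult q ev_mpoly_of_poly)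
  then show False using h by (metis ev_one zero_neq_one)
qed

end
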